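(* Let $F$ be a field with $\operatorname{char}(F)\neq2$. (i) Among the two-dimensional Poisson algebras $P_{2,1},\dots,P_{2,5},P_{2,6}(E),P_{2,7}$ over $F$ (defined in the context), the nilpotent ones are precisely $P_{2,1}$ and $P_{2,2}$. (ii) Among the three-dimensional Poisson algebras $P_{3,1},\dots,P_{3,21}(A)$ and $P_{3,23}(\mathfrak s)$ over $F$ (defined in the context), the nilpotent ones are precisely $$P_{3,1},\quad P_{3,3},\quad P_{3,4}(M),\quad P_{3,5},\quad P_{3,16}(M)$$ (for all admissible values of the parameter $M$ in each family). Here nilpotency is understood in the sense of the series $\mathcal N_n(P)$ defined in the context, which involves both multiplications.
   Context: A Poisson algebra over a field $F$ is an $F$-vector space $P$ with two $F$-bilinear operations: a commutative associative multiplication $(x,y)\mapsto xy$ (not assumed to have an identity) and a Lie multiplication $(x,y)\mapsto[x,y]$ (alternating, $[x,x]=0$ for all $x$, and satisfying the Jacobi identity), such that $[xy,z]=x[y,z]+y[x,z]$ for all $x,y,z\in P$. Nilpotency: put $\mathcal N_0(P)=P$ and $\mathcal N_{n+1}(P)=\mathcal N_n(P)P+[\mathcal N_n(P),P]$, where $ST$ and $[S,T]$ denote the $F$-spans of all products, respectively brackets, of elements of $S$ and $T$. $P$ is nilpotent if $\mathcal N_m(P)=0$ for some $m$. In the following lists, all products and brackets of basis elements that are neither displayed nor determined from the displayed ones by commutativity, bilinearity and alternation are zero. Two-dimensional algebras: - $P_{2,1}=Fa\oplus Fb$: all products and brackets zero. - $P_{2,2}=Fa\oplus Fb$: $a^2=b$.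 - $P_{2,3}=Fe\oplus Fb$: $e^2=e$. - $P_{2,4}=Fe_1\oplus Fe_2$: $e_1^2=e_1$, $e_2^2=e_2$, $e_1e_2=0$. - $P_{2,5}=Fe\oplus Fu$: $e^2=e$, $eu=u$, $u^2=0$. - $P_{2,6}(E)=E$, a quadratic field extension of $F$ with its ordinary multiplication and zero Lie multiplication. - $P_{2,7}=Fa\oplus Fb$: $[a,b]=b$, zero associative multiplication. Three-dimensional algebras with zero Lie multiplication: - $P_{3,1}$: all associative products zero. - $P_{3,2}=Fe\oplus Fx\oplus Fy$: $e^2=e$. - $P_{3,3}=Fx\oplus Fy\oplus Fz$: $x^2=z$. - $P_{3,4}(M)=Fx\oplus Fy\oplus Fz$: $x^2=\alpha z$, $xy=\beta z$, $y^2=\gamma z$, where $M=\begin{pmatrix}\alpha&\beta\\ \beta&\gamma\end{pmatrix}$, $\det M\ne0$. - $P_{3,5}=Fx\oplus Fy\oplus Fz$: $x^2=y$, $xy=z$. - $P_{3,6}=Fe\oplus Fx\oplus Fy$: $e^2=e$, $x^2=y$. - $P_{3,7}=Fe_1\oplus Fe_2\oplus Fz$: $e_1^2=e_1$, $e_2^2=e_2$. - $P_{3,8}=Fe\oplus Fu\oplus Fz$: $e^2=e$, $eu=u$, $u^2=0$. - $P_{3,9}(E)=E\oplus Fz$, $E/F$ a quadratic field extension with its ordinary multiplication, $z$ multiplying every element to $0$. - $P_{3,10}\cong F\times F\times F$; $P_{3,11}\cong F\times F[\varepsilon]/(\varepsilon^2)$; $P_{3,12}(E)\cong F\times E$ with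 $E/F$ a quadratic field extension; $P_{3,13}(K)=K$ with $K/F$ a cubic field extension. - $P_{3,14}=Fe\oplus Fu\oplus Fv$: $e^2=e$, $eu=u$, $ev=v$, $u^2=uv=v^2=0$. - $P_{3,15}=Fe\oplus Fu\oplus Fv$: $e^2=e$, $eu=u$, $ev=v$, $u^2=v$, $uv=v^2=0$. Three-dimensional algebras with non-zero Lie multiplication: - $P_{3,16}(M)=Fx\oplus Fy\oplus Fz$: $[x,y]=z$, $x^2=\alpha z$, $xy=\beta z$, $y^2=\gamma z$, where $M=\begin{pmatrix}\alpha&\beta\\ \beta&\gamma\end{pmatrix}$ is any symmetric matrix over $F$ (possibly zero). - On $Fx\oplus Fy\oplus Fz$ with $[x,y]=y$: $P_{3,17}$ (zero associative multiplication); $P_{3,18}$: $x^2=z$; $P_{3,19}$: $z^2=z$; $P_{3,20}$: $z^2=z$, $zx=x$, $zy=y$. - $P_{3,21}(A)=Fx\oplus V$ with $V=F^2$, $A\in GL_2(F)$: $[x,v]=A(v)$ for $v\in V$, $[V,V]=0$, zero associative multiplication. - $P_{3,23}(\mathfrak s)$: a three-dimensional simple Lie algebra $\mathfrak s$ over $F$ with zero associative multiplication. (A further family $P_{3,22}(q)$ of the three-dimensional classification occurs only in characteristic $2$.) *)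

theory Defs
  imports "HOL-Analysis.Analysis" "HOL-Computational_Algebra.Polynomial"
begin

section \<open>Lie algebras and Poisson algebras\<close>

locale lie_algebra = vector_space scl
  for scl :: "'f::field \<Rightarrow> 'a::ab_group_add \<Rightarrow> 'a" +
  fixes brk :: "'a \<Rightarrow> 'a \<Rightarrow> 'a"
  assumes brk_add_left: "brk (x + y) z = brk x z + brk y z"
    and brk_add_right: "brk x (y + z) = brk x y + brk x z"
    and brk_scale_left: "brk (scl c x) y = scl c (brk x y)"
    and brk_scale_right: "brk x (scl c y) = scl c (brk x y)"
    and brk_self: "brk x x = 0"
    and jacobi: "brk x (brk y z) + brk y (brk z x) + brk z (brk x y) = 0"

record ('f, 'a) poisson_data =
  scl :: "'f \<Rightarrow> 'a \<Rightarrow> 'a"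
  asc :: "'a \<Rightarrow> 'a \<Rightarrow> 'a"
  brk :: "'a \<Rightarrow> 'a \<Rightarrow> 'a"

locale poisson_algebra = lie_algebra "scl P" "brk P"
  for P :: "('f::field, 'a::ab_group_add) poisson_data" +
  assumes asc_add_left: "asc P (x + y) z = asc P x z + asc P y z"
    and asc_scale_left: "asc P (scl P c x) y = scl P c (asc P x y)"
    and asc_commute: "asc P x y = asc P y x"
    and asc_assoc: "asc P (asc P x y) z = asc P x (asc P y z)"
    and leibniz: "brk P (asc P x y) z = asc P x (brk P y z) + asc P y (brk P x z)"

primrec nil_series :: "('f::field, 'a::ab_group_add) poisson_data \<Rightarrow> nat \<Rightarrow> 'a set" where
  "nil_series P 0 = UNIV"
| "nil_series P (Suc n) =
    {u + v | u v.
       u \<in> module.span (scl P) {asc P x y | x y. x \<in> nil_series P n} \<and>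
       v \<in> module.span (scl P) {brk P x y | x y. x \<in> nil_series P n}}"

definition poisson_nilpotent :: "('f::field, 'a::ab_group_add) poisson_data \<Rightarrow> bool" where
  "poisson_nilpotent P \<longleftrightarrow> (\<exists>m. nil_series P m = {0})"

definition simple_lie_algebra ::
    "('f::field \<Rightarrow> 'a::ab_group_add \<Rightarrow> 'a) \<Rightarrow> ('a \<Rightarrow> 'a \<Rightarrow> 'a) \<Rightarrow> bool" where
  "simple_lie_algebra s b \<longleftrightarrow>
     lie_algebra s b \<and> (\<exists>x y. b x y \<noteq> 0) \<and>
     (\<forall>I. module.subspace s I \<and> (\<forall>x\<in>I. \<forall>y. b x y \<in> I) \<longrightarrow> I = {0} \<or> I = UNIV)"

section \<open>Field extensions\<close>

text \<open>A field extension is given by its embedding \<open>h\<close>; an infinite extension has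
  \<open>dim UNIV = 0\<close> in the library, so it is excluded for \<open>n > 0\<close>.\<close>

definition field_extension_of_degree :: "nat \<Rightarrow> ('f::field \<Rightarrow> 'e::field) \<Rightarrow> bool" where
  "field_extension_of_degree n h \<longleftrightarrow>
     h 1 = 1 \<and> (\<forall>x y. h (x + y) = h x + h y) \<and> (\<forall>x y. h (x * y) = h x * h y) \<and>
     vector_space.dim (\<lambda>c x. h c * x) UNIV = n"

section \<open>Building blocks\<close>

abbreviation ee :: "'n \<Rightarrow> 'f::field ^ 'n::finite" where
  "ee i \<equiv> axis i 1"

text \<open>
  An entry \<open>(i, j, v)\<close> of a table says that the product (bracket) of the \<open>i\<close>-th and the
  \<open>j\<close>-th basis vector is \<open>v\<close>. The operation is the bilinear extension, symmetric for
  \<open>comm_table\<close> and alternating for \<open>lie_table\<close>; products not determined by the table are zero.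
  Each unordered pair \<open>{i, j}\<close> may be listed only once.
\<close>

definition comm_table ::
    "('n \<times> 'n \<times> ('f ^ 'n)) list \<Rightarrow> 'f ^ 'n \<Rightarrow> 'f ^ 'n \<Rightarrow> 'f::field ^ 'n::finite" where
  "comm_table T x y =
     (\<Sum>(i, j, v) \<leftarrow> T. (if i = j then x $ i * y $ i else x $ i * y $ j + x $ j * y $ i) *s v)"

definition lie_table ::
    "('n \<times> 'n \<times> ('f ^ 'n)) list \<Rightarrow> 'f ^ 'n \<Rightarrow> 'f ^ 'n \<Rightarrow> 'f::field ^ 'n::finite" where
  "lie_table T x y = (\<Sum>(i, j, v) \<leftarrow> T. (x $ i * y $ j - x $ j * y $ i) *s v)"

definition table_algebra ::
    "('n \<times> 'n \<times> ('f ^ 'n)) list \<Rightarrow> ('n \<times> 'n \<times> ('f ^ 'n)) list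
      \<Rightarrow> ('f::field, 'f ^ 'n::finite) poisson_data" where
  "table_algebra A L = \<lparr>scl = (*s), asc = comm_table A, brk = lie_table L\<rparr>"

definition extension_algebra :: "('f::field \<Rightarrow> 'e::field) \<Rightarrow> ('f, 'e) poisson_data" where
  "extension_algebra h = \<lparr>scl = (\<lambda>c x. h c * x), asc = (*), brk = (\<lambda>_ _. 0)\<rparr>"

definition base_field :: "('f::field, 'f) poisson_data" where
  "base_field = \<lparr>scl = (*), asc = (*), brk = (\<lambda>_ _. 0)\<rparr>"

definition zero_line :: "('f::field, 'f) poisson_data" where
  "zero_line = \<lparr>scl = (*), asc = (\<lambda>_ _. 0), brk = (\<lambda>_ _. 0)\<rparr>"

text \<open>\<open>F[\<epsilon>]/(\<epsilon>\<^sup>2)\<close>, with \<open>(a, b)\<close> standing for the class of \<open>a + b\<epsilon>\<close>;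
  see \<open>dual_numbers_quotient\<close> below.\<close>

definition dual_numbers :: "('f::field, 'f \<times> 'f) poisson_data" where
  "dual_numbers =
     \<lparr>scl = (\<lambda>c (a, b). (c * a, c * b)),
      asc = (\<lambda>(a, b) (c, d). (a * c, a * d + b * c)),
      brk = (\<lambda>_ _. 0)\<rparr>"

definition direct_product ::
    "('f::field, 'a::ab_group_add) poisson_data \<Rightarrow> ('f, 'b::ab_group_add) poisson_data
      \<Rightarrow> ('f, 'a \<times> 'b) poisson_data" where
  "direct_product P Q =
     \<lparr>scl = (\<lambda>c (x, y). (scl P c x, scl Q c y)),
      asc = (\<lambda>(x, y) (x', y'). (asc P x x', asc Q y y')),
      brk = (\<lambda>(x, y) (x', y'). (brk P x x', brk Q y y'))\<rparr>"

section \<open>The two-dimensional algebras\<close>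

text \<open>Below, the basis vectors of an algebra given by tables are numbered in the order in which
  the comment lists them. In the index types, \<open>2 :: 2\<close> and \<open>3 :: 3\<close> are the residues \<open>0\<close>, so
  \<open>1, 2\<close> and \<open>1, 2, 3\<close> enumerate the types \<open>2\<close> and \<open>3\<close>.\<close>

type_synonym 'f alg2 = "('f, 'f ^ 2) poisson_data"
type_synonym 'f alg3 = "('f, 'f ^ 3) poisson_data"

definition P2_1 :: "'f::field alg2" where  \<comment> \<open>\<open>a, b\<close>\<close>
  "P2_1 = table_algebra [] []"

definition P2_2 :: "'f::field alg2" where  \<comment> \<open>\<open>a, b\<close>\<close>
  "P2_2 = table_algebra [(1, 1, ee 2)] []"

definition P2_3 :: "'f::field alg2" where  \<comment> \<open>\<open>e, b\<close>\<close>
  "P2_3 = table_algebra [(1, 1, ee 1)] []"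

definition P2_4 :: "'f::field alg2" where  \<comment> \<open>\<open>e\<^sub>1, e\<^sub>2\<close>\<close>
  "P2_4 = table_algebra [(1, 1, ee 1), (2, 2, ee 2)] []"

definition P2_5 :: "'f::field alg2" where  \<comment> \<open>\<open>e, u\<close>\<close>
  "P2_5 = table_algebra [(1, 1, ee 1), (1, 2, ee 2)] []"

definition P2_6 :: "('f::field \<Rightarrow> 'e::field) \<Rightarrow> ('f, 'e) poisson_data" where
  "P2_6 h = extension_algebra h"

definition P2_7 :: "'f::field alg2" where  \<comment> \<open>\<open>a, b\<close>\<close>
  "P2_7 = table_algebra [] [(1, 2, ee 2)]"

section \<open>The three-dimensional algebras with zero Lie multiplication\<close>

definition P3_1 :: "'f::field alg3" where
  "P3_1 = table_algebra [] []"

definition P3_2 :: "'f::field alg3" where  \<comment> \<open>\<open>e, x, y\<close>\<close>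
  "P3_2 = table_algebra [(1, 1, ee 1)] []"

definition P3_3 :: "'f::field alg3" where  \<comment> \<open>\<open>x, y, z\<close>\<close>
  "P3_3 = table_algebra [(1, 1, ee 3)] []"

definition P3_4 :: "'f::field ^ 2 ^ 2 \<Rightarrow> 'f alg3" where  \<comment> \<open>\<open>x, y, z\<close>\<close>
  "P3_4 M = table_algebra
     [(1, 1, (M $ 1 $ 1) *s ee 3), (1, 2, (M $ 1 $ 2) *s ee 3), (2, 2, (M $ 2 $ 2) *s ee 3)] []"

definition P3_5 :: "'f::field alg3" where  \<comment> \<open>\<open>x, y, z\<close>\<close>
  "P3_5 = table_algebra [(1, 1, ee 2), (1, 2, ee 3)] []"

definition P3_6 :: "'f::field alg3" where  \<comment> \<open>\<open>e, x, y\<close>\<close>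
  "P3_6 = table_algebra [(1, 1, ee 1), (2, 2, ee 3)] []"

definition P3_7 :: "'f::field alg3" where  \<comment> \<open>\<open>e\<^sub>1, e\<^sub>2, z\<close>\<close>
  "P3_7 = table_algebra [(1, 1, ee 1), (2, 2, ee 2)] []"

definition P3_8 :: "'f::field alg3" where  \<comment> \<open>\<open>e, u, z\<close>\<close>
  "P3_8 = table_algebra [(1, 1, ee 1), (1, 2, ee 2)] []"

definition P3_9 :: "('f::field \<Rightarrow> 'e::field) \<Rightarrow> ('f, 'e \<times> 'f) poisson_data" where
  "P3_9 h = direct_product (extension_algebra h) zero_line"

definition P3_10 :: "('f::field, 'f \<times> 'f \<times> 'f) poisson_data" where
  "P3_10 = direct_product base_field (direct_product base_field base_field)"

definition P3_11 :: "('f::field, 'f \<times> 'f \<times> 'f) poisson_data" where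
  "P3_11 = direct_product base_field dual_numbers"

definition P3_12 :: "('f::field \<Rightarrow> 'e::field) \<Rightarrow> ('f, 'f \<times> 'e) poisson_data" where
  "P3_12 h = direct_product base_field (extension_algebra h)"

definition P3_13 :: "('f::field \<Rightarrow> 'k::field) \<Rightarrow> ('f, 'k) poisson_data" where
  "P3_13 h = extension_algebra h"

definition P3_14 :: "'f::field alg3" where  \<comment> \<open>\<open>e, u, v\<close>\<close>
  "P3_14 = table_algebra [(1, 1, ee 1), (1, 2, ee 2), (1, 3, ee 3)] []"

definition P3_15 :: "'f::field alg3" where  \<comment> \<open>\<open>e, u, v\<close>\<close>
  "P3_15 = table_algebra [(1, 1, ee 1), (1, 2, ee 2), (1, 3, ee 3), (2, 2, ee 3)] []"

section \<open>The three-dimensional algebras with non-zero Lie multiplication\<close>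

definition P3_16 :: "'f::field ^ 2 ^ 2 \<Rightarrow> 'f alg3" where  \<comment> \<open>\<open>x, y, z\<close>\<close>
  "P3_16 M = table_algebra
     [(1, 1, (M $ 1 $ 1) *s ee 3), (1, 2, (M $ 1 $ 2) *s ee 3), (2, 2, (M $ 2 $ 2) *s ee 3)]
     [(1, 2, ee 3)]"

definition P3_17 :: "'f::field alg3" where  \<comment> \<open>\<open>x, y, z\<close>\<close>
  "P3_17 = table_algebra [] [(1, 2, ee 2)]"

definition P3_18 :: "'f::field alg3" where  \<comment> \<open>\<open>x, y, z\<close>\<close>
  "P3_18 = table_algebra [(1, 1, ee 3)] [(1, 2, ee 2)]"

definition P3_19 :: "'f::field alg3" where  \<comment> \<open>\<open>x, y, z\<close>\<close>
  "P3_19 = table_algebra [(3, 3, ee 3)] [(1, 2, ee 2)]"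

definition P3_20 :: "'f::field alg3" where  \<comment> \<open>\<open>x, y, z\<close>\<close>
  "P3_20 = table_algebra [(3, 3, ee 3), (3, 1, ee 1), (3, 2, ee 2)] [(1, 2, ee 2)]"

text \<open>The pair \<open>(s, v)\<close> stands for \<open>s x + v\<close>.\<close>

definition P3_21 :: "'f::field ^ 2 ^ 2 \<Rightarrow> ('f, 'f \<times> ('f ^ 2)) poisson_data" where
  "P3_21 A =
     \<lparr>scl = (\<lambda>c (s, v). (c * s, c *s v)),
      asc = (\<lambda>_ _. 0),
      brk = (\<lambda>(s, v) (t, w). (0, s *s (A *v w) - t *s (A *v v)))\<rparr>"

definition P3_23 ::
    "('f::field \<Rightarrow> 'a::ab_group_add \<Rightarrow> 'a) \<Rightarrow> ('a \<Rightarrow> 'a \<Rightarrow> 'a) \<Rightarrow> ('f, 'a) poisson_data" where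
  "P3_23 s b = \<lparr>scl = s, asc = (\<lambda>_ _. 0), brk = b\<rparr>"

section \<open>The listed algebras are Poisson algebras\<close>

lemma dual_numbers_quotient:
  fixes \<phi> :: "'f::field poly \<Rightarrow> 'f \<times> 'f"
  defines "\<phi> \<equiv> \<lambda>p. (coeff p 0, coeff p 1)"
  shows "\<phi> (p + q) = \<phi> p + \<phi> q" "\<phi> (smult c p) = scl dual_numbers c (\<phi> p)"
    "\<phi> (p * q) = asc dual_numbers (\<phi> p) (\<phi> q)"
    "surj \<phi>" "\<phi> p = 0 \<longleftrightarrow> [:0, 1:]^2 dvd p"
proof -
  show "\<phi> (p + q) = \<phi> p + \<phi> q" by (simp add: \<phi>_def)
  show "\<phi> (smult c p) = scl dual_numbers c (\<phi> p)" by (simp add: \<phi>_def dual_numbers_def)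
  show "\<phi> (p * q) = asc dual_numbers (\<phi> p) (\<phi> q)"
    by (simp add: \<phi>_def dual_numbers_def coeff_mult atMost_Suc)
  show "surj \<phi>"
  proof
    show "UNIV \<subseteq> range \<phi>"
    proof
      fix x :: "'f \<times> 'f"
      have "x = \<phi> [:fst x, snd x:]" by (simp add: \<phi>_def)
      then show "x \<in> range \<phi>" by blast
    qed
  qed simp
  have "[:0, 1:]^2 = monom (1::'f) 2" by (simp add: monom_altdef)
  then show "\<phi> p = 0 \<longleftrightarrow> [:0, 1:]^2 dvd p"
    by (auto simp: \<phi>_def monom_1_dvd_iff' zero_prod_def numeral_2_eq_2 less_Suc_eq)
qed

lemma poisson_table2:
  "poisson_algebra (P2_1 :: 'f::field alg2)" "poisson_algebra (P2_2 :: 'f alg2)"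
  "poisson_algebra (P2_3 :: 'f alg2)" "poisson_algebra (P2_4 :: 'f alg2)"
  "poisson_algebra (P2_5 :: 'f alg2)" "poisson_algebra (P2_7 :: 'f alg2)"
  by (unfold_locales;
      simp add: P2_1_def P2_2_def P2_3_def P2_4_def P2_5_def P2_7_def table_algebra_def
        comm_table_def lie_table_def vec_eq_iff forall_2 axis_def algebra_simps)+

lemma poisson_table3:
  "poisson_algebra (P3_1 :: 'f::field alg3)" "poisson_algebra (P3_2 :: 'f alg3)"
  "poisson_algebra (P3_3 :: 'f alg3)" "poisson_algebra (P3_4 M :: 'f alg3)"
  "poisson_algebra (P3_5 :: 'f alg3)" "poisson_algebra (P3_6 :: 'f alg3)"
  "poisson_algebra (P3_7 :: 'f alg3)" "poisson_algebra (P3_8 :: 'f alg3)"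
  "poisson_algebra (P3_14 :: 'f alg3)" "poisson_algebra (P3_15 :: 'f alg3)"
  "poisson_algebra (P3_16 M :: 'f alg3)" "poisson_algebra (P3_17 :: 'f alg3)"
  "poisson_algebra (P3_18 :: 'f alg3)" "poisson_algebra (P3_19 :: 'f alg3)"
  "poisson_algebra (P3_20 :: 'f alg3)"
  by (unfold_locales;
      simp add: P3_1_def P3_2_def P3_3_def P3_4_def P3_5_def P3_6_def P3_7_def P3_8_def
        P3_14_def P3_15_def P3_16_def P3_17_def P3_18_def P3_19_def P3_20_def table_algebra_def
        comm_table_def lie_table_def vec_eq_iff forall_3 axis_def algebra_simps)+

lemma poisson_extension_algebra:
  assumes "field_extension_of_degree n h"
  shows "poisson_algebra (extension_algebra h)"
  using assms
  by unfold_locales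
    (simp_all add: extension_algebra_def field_extension_of_degree_def algebra_simps)

lemma poisson_base_field: "poisson_algebra base_field"
  by unfold_locales (simp_all add: base_field_def algebra_simps)

lemma poisson_zero_line: "poisson_algebra zero_line"
  by unfold_locales (simp_all add: zero_line_def algebra_simps)

lemma poisson_dual_numbers: "poisson_algebra dual_numbers"
  by unfold_locales (auto simp: dual_numbers_def algebra_simps zero_prod_def)

lemma poisson_direct_product:
  assumes "poisson_algebra P" "poisson_algebra Q"
  shows "poisson_algebra (direct_product P Q)"
proof -
  interpret P: poisson_algebra P by fact
  interpret Q: poisson_algebra Q by fact
  show ?thesis
    by unfold_locales
      (auto simp: direct_product_def zero_prod_def P.scale_right_distrib Q.scale_right_distrib
         P.scale_left_distrib Q.scale_left_distrib P.brk_add_left Q.brk_add_left P.brk_add_right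
         Q.brk_add_right P.brk_scale_left Q.brk_scale_left P.brk_scale_right Q.brk_scale_right
         P.brk_self Q.brk_self P.jacobi Q.jacobi P.asc_add_left Q.asc_add_left P.asc_scale_left
         Q.asc_scale_left P.asc_assoc Q.asc_assoc P.leibniz Q.leibniz
         intro: P.asc_commute Q.asc_commute)
qed

lemma poisson_P2_6: "field_extension_of_degree 2 h \<Longrightarrow> poisson_algebra (P2_6 h)"
  and poisson_P3_9: "field_extension_of_degree 2 h \<Longrightarrow> poisson_algebra (P3_9 h)"
  and poisson_P3_12: "field_extension_of_degree 2 h \<Longrightarrow> poisson_algebra (P3_12 h)"
  and poisson_P3_13: "field_extension_of_degree 3 k \<Longrightarrow> poisson_algebra (P3_13 k)"
  and poisson_P3_10: "poisson_algebra P3_10"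
  and poisson_P3_11: "poisson_algebra P3_11"
  unfolding P2_6_def P3_9_def P3_12_def P3_13_def P3_10_def P3_11_def
  by (auto intro: poisson_direct_product poisson_extension_algebra poisson_base_field
      poisson_zero_line poisson_dual_numbers)

lemma poisson_P3_21: "poisson_algebra (P3_21 A)"
  by unfold_locales
    (auto simp: P3_21_def zero_prod_def vec_eq_iff forall_2 matrix_vector_mult_def sum_2
       algebra_simps)

lemma poisson_P3_23:
  assumes "lie_algebra s b"
  shows "poisson_algebra (P3_23 s b)"
proof -
  interpret lie_algebra s b by fact
  have "b 0 z = 0" for z
    using brk_scale_left[of 0 0 z] by simp
  then show ?thesis
    by unfold_locales
      (simp_all add: P3_23_def scale_right_distrib scale_left_distrib brk_add_left brk_add_right
         brk_scale_left brk_scale_right brk_self jacobi)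
qed

end

theory Submission
  imports Defs
begin

text \<open>
  Nilpotency of the listed algebras is decided by two complementary criteria.

  An algebra fails to be nilpotent as soon as it has a set \<open>K\<close> that contains a nonzero vector and lies
  in the span of the products and brackets of its own elements with arbitrary ones: by induction, every
  term of the series contains such a \<open>K\<close> (\<open>not_nilpotent_if_self_generating\<close>). In almost every
  non-nilpotent algebra of the lists, \<open>K\<close> can be a single vector: a nonzero idempotent, or a vector \<open>b\<close> with \<open>[b, y] = b\<close> for some \<open>y\<close>.
  In particular the unit of a field extension is such an idempotent, alone or as a factor of a direct
  product. Only two families need a larger \<open>K\<close>: the subspace \<open>V\<close> in \<open>P\<^sub>3\<^sub>,\<^sub>2\<^sub>1(A)\<close>, on which
  bracketing with \<open>-x\<close> acts as the surjection \<open>A\<close>, and all of a simple Lie algebra, which is perfect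
  because its derived algebra is a nonzero ideal.

  Conversely, the nilpotent algebras in the lists have a basis with weights such that every product
  and every bracket of basis vectors is a combination of basis vectors of strictly larger weight
  than both arguments. Then the \<open>n\<close>-th term of the series lives in weights \<open>\<ge> n\<close>, hence vanishes
  once \<open>n\<close> exceeds all weights (\<open>nilpotent_table_algebra\<close>).
\<close>

section \<open>Obstructions to nilpotency\<close>

context poisson_algebra
begin

lemma nil_series_Suc_span:
  "nil_series P (Suc n) =
     span ({asc P x y | x y. x \<in> nil_series P n} \<union> {brk P x y | x y. x \<in> nil_series P n})"
  by (simp add: span_Un Setcompr_eq_image)

lemma not_nilpotent_if_self_generating:
  assumes K: "K \<subseteq> span ({asc P x y | x y. x \<in> K} \<union> {brk P x y | x y. x \<in> K})"
    and k: "k \<in> K" "k \<noteq> 0"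
  shows "\<not> poisson_nilpotent P"
proof -
  have "K \<subseteq> nil_series P n" for n
  proof (induction n)
    case (Suc n)
    have "span ({asc P x y | x y. x \<in> K} \<union> {brk P x y | x y. x \<in> K}) \<subseteq> nil_series P (Suc n)"
      unfolding nil_series_Suc_span using Suc.IH by (intro span_mono) blast
    with K show ?case by blast
  qed simp
  with k show ?thesis unfolding poisson_nilpotent_def by blast
qed

lemma not_nilpotent_if_reproduced:
  assumes "x \<noteq> 0" "asc P x y = x \<or> brk P x y = x"
  shows "\<not> poisson_nilpotent P"
proof (rule not_nilpotent_if_self_generating)
  have "x \<in> {asc P u v | u v. u \<in> {x}} \<union> {brk P u v | u v. u \<in> {x}}"
    by (metis (mono_tags, lifting) UnCI mem_Collect_eq assms(2) singletonI)
  then show "{x} \<subseteq> span ({asc P u v | u v. u \<in> {x}} \<union> {brk P u v | u v. u \<in> {x}})"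
    by (simp add: span_base)
qed (use assms in auto)

end

lemma not_nilpotent_extension_algebra:
  assumes "field_extension_of_degree n h"
  shows "\<not> poisson_nilpotent (extension_algebra h)"
proof (rule poisson_algebra.not_nilpotent_if_reproduced[where x = 1 and y = 1])
  show "poisson_algebra (extension_algebra h)"
    using assms by (rule poisson_extension_algebra)
qed (simp_all add: extension_algebra_def)

lemma not_nilpotent_direct_product:
  assumes "poisson_algebra P" "poisson_algebra Q" "e \<noteq> 0" "asc P e e = e"
  shows "\<not> poisson_nilpotent (direct_product P Q)"
proof (rule poisson_algebra.not_nilpotent_if_reproduced[where x = "(e, 0)" and y = "(e, 0)"])
  show "poisson_algebra (direct_product P Q)"
    using assms(1,2) by (rule poisson_direct_product)
  interpret Q: poisson_algebra Q by fact
  have "asc Q 0 0 = 0"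
    using Q.asc_scale_left[of 0 0 0] by simp
  with assms show "asc (direct_product P Q) (e, 0) (e, 0) = (e, 0) \<or>
      brk (direct_product P Q) (e, 0) (e, 0) = (e, 0)"
    by (simp add: direct_product_def)
qed (use assms in \<open>simp add: zero_prod_def\<close>)

lemma not_nilpotent_P3_21:
  assumes "invertible A"
  shows "\<not> poisson_nilpotent (P3_21 A)"
proof -
  interpret poisson_algebra "P3_21 A" by (rule poisson_P3_21)
  obtain B where B: "A ** B = mat 1"
    using assms by (auto simp: invertible_def)
  show ?thesis
  proof (rule not_nilpotent_if_self_generating)
    let ?K = "range (Pair 0)"
    let ?G = "{asc (P3_21 A) x y | x y. x \<in> ?K} \<union> {brk (P3_21 A) x y | x y. x \<in> ?K}"
    show "?K \<subseteq> span ?G"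
    proof (rule image_subsetI)
      fix v :: "'a ^ 2"
      \<comment> \<open>The bracket of \<open>w \<in> V\<close> with \<open>-x\<close> is \<open>[x, w] = A(w)\<close>.\<close>
      have "(0, v) = brk (P3_21 A) (0, B *v v) (- 1, 0)"
        by (simp add: P3_21_def matrix_vector_mul_assoc B)
      then have "(0, v) \<in> ?G" by blast
      then show "(0, v) \<in> span ?G" by (rule span_base)
    qed
    show "(0, ee 1) \<in> ?K" by blast
    show "(0, ee 1) \<noteq> (0 :: 'a \<times> ('a ^ 2))" by (simp add: zero_prod_def axis_eq_0_iff)
  qed
qed

lemma not_nilpotent_simple_lie_algebra:
  assumes "simple_lie_algebra s b"
  shows "\<not> poisson_nilpotent (P3_23 s b)"
proof -
  have lie: "lie_algebra s b"
    using assms by (simp add: simple_lie_algebra_def)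
  interpret lie_algebra s b by fact
  obtain x y where xy: "b x y \<noteq> 0"
    using assms by (auto simp: simple_lie_algebra_def)
  let ?D = "span {b u v | u v. True}"
  have mem: "b u v \<in> ?D" for u v
    by (rule span_base) blast
  have "?D = {0} \<or> ?D = UNIV"
    using assms mem by (auto simp: simple_lie_algebra_def)
  with mem[of x y] xy have perfect: "?D = UNIV" by auto
  show ?thesis
  proof (rule poisson_algebra.not_nilpotent_if_self_generating)
    show "poisson_algebra (P3_23 s b)"
      using lie by (rule poisson_P3_23)
    have "?D \<subseteq> span ({asc (P3_23 s b) u v | u v. u \<in> UNIV} \<union> {brk (P3_23 s b) u v | u v. u \<in> UNIV})"
      by (intro span_mono) (auto simp: P3_23_def)
    then show "UNIV \<subseteq> module.span (scl (P3_23 s b))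
        ({asc (P3_23 s b) u v | u v. u \<in> UNIV} \<union> {brk (P3_23 s b) u v | u v. u \<in> UNIV})"
      using perfect by (simp add: P3_23_def)
  qed (use xy in auto)
qed

section \<open>Nilpotency from a weighted basis\<close>

lemma comm_table_coord_zero:
  assumes "\<And>i j v. (i, j, v) \<in> set T \<Longrightarrow> v $ k \<noteq> 0 \<Longrightarrow> x $ i = 0 \<and> x $ j = 0"
  shows "comm_table T x y $ k = 0"
  using assms by (induction T) (force simp: comm_table_def)+

lemma lie_table_coord_zero:
  assumes "\<And>i j v. (i, j, v) \<in> set T \<Longrightarrow> v $ k \<noteq> 0 \<Longrightarrow> x $ i = 0 \<and> x $ j = 0"
  shows "lie_table T x y $ k = 0"
  using assms by (induction T) (force simp: lie_table_def)+

text \<open>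
  Multiplication raises weights, so the \<open>n\<close>-th term of the series consists of vectors all of whose
  coordinates of weight \<open>< n\<close> vanish. The bound must be strict for both indices of a table entry: the
  second factor is arbitrary, possibly of weight \<open>0\<close>, and the factor taken from the series can stand
  in either position of the entry.
\<close>

lemma nilpotent_table_algebra:
  fixes w :: "'n::finite \<Rightarrow> nat" and A L :: "('n \<times> 'n \<times> ('f::field ^ 'n)) list"
  assumes raise: "\<And>i j v k. (i, j, v) \<in> set A \<union> set L \<Longrightarrow> v $ k \<noteq> 0 \<Longrightarrow> w i < w k \<and> w j < w k"
  shows "poisson_nilpotent (table_algebra A L)"
proof -
  let ?P = "table_algebra A L"
  define U where "U n = {x :: 'f ^ 'n. \<forall>i. w i < n \<longrightarrow> x $ i = 0}" for n
  have subspace_U: "vec.subspace (U n)" for n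
    by (auto simp: U_def vec.subspace_def)
  have scl: "scl ?P = (*s)"
    by (simp add: table_algebra_def)
  have asc: "asc ?P x y \<in> U (Suc n)" and brk: "brk ?P x y \<in> U (Suc n)" if "x \<in> U n" for x y n
  proof -
    have *: "x $ i = 0 \<and> x $ j = 0"
      if "w k < Suc n" "(i, j, v) \<in> set A \<union> set L" "v $ k \<noteq> 0" for i j k v
      using raise[OF that(2,3)] \<open>x \<in> U n\<close> that(1) by (auto simp: U_def)
    show "asc ?P x y \<in> U (Suc n)"
      unfolding U_def table_algebra_def using * by (auto intro!: comm_table_coord_zero)
    show "brk ?P x y \<in> U (Suc n)"
      unfolding U_def table_algebra_def using * by (auto intro!: lie_table_coord_zero)
  qed
  have sub: "nil_series ?P n \<subseteq> U n" for n
  proof (induction n)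
    case 0
    show ?case by (simp add: U_def)
  next
    case (Suc n)
    have "vec.span {asc ?P x y | x y. x \<in> nil_series ?P n} \<subseteq> U (Suc n)"
      using Suc.IH asc by (intro vec.span_minimal subspace_U) blast
    moreover have "vec.span {brk ?P x y | x y. x \<in> nil_series ?P n} \<subseteq> U (Suc n)"
      using Suc.IH brk by (intro vec.span_minimal subspace_U) blast
    ultimately show ?case
      using subspace_U by (auto simp: scl intro!: vec.subspace_add)
  qed
  have zero: "0 \<in> nil_series ?P n" for n
  proof (cases n)
    case (Suc m)
    show ?thesis
      unfolding Suc nil_series.simps scl
      by (rule CollectI, intro exI[of _ 0] conjI) (simp_all add: vec.span_zero)
  qed simp
  have "w i < Suc (Max (range w))" for i
    by (simp add: less_Suc_eq_le)
  then have "U (Suc (Max (range w))) \<subseteq> {0}"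
    by (auto simp: U_def vec_eq_iff)
  then have "nil_series ?P (Suc (Max (range w))) = {0}"
    using sub zero by blast
  then show ?thesis unfolding poisson_nilpotent_def by blast
qed

section \<open>The classification lists\<close>

lemmas table_defs = table_algebra_def comm_table_def lie_table_def vec_eq_iff forall_2 forall_3 axis_def

lemma nilpotent_dim2:
  "poisson_nilpotent (P2_1 :: 'f::field alg2)"
  "poisson_nilpotent (P2_2 :: 'f::field alg2)"
  unfolding P2_1_def P2_2_def
  by (rule nilpotent_table_algebra[where w = "\<lambda>i. if i = 2 then 1 else 0"];
      auto simp: axis_def split: if_splits)+

lemma nilpotent_dim3:
  "poisson_nilpotent (P3_1 :: 'f::field alg3)"
  "poisson_nilpotent (P3_3 :: 'f::field alg3)"
  "poisson_nilpotent (P3_4 M)"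
  "poisson_nilpotent (P3_16 M)"
  unfolding P3_1_def P3_3_def P3_4_def P3_16_def
  by (rule nilpotent_table_algebra[where w = "\<lambda>i. if i = 3 then 1 else 0"];
      auto simp: axis_def split: if_splits)+

text \<open>Since \<open>y = x\<^sup>2\<close> and \<open>z = x y\<close>, the basis vectors \<open>x, y, z\<close> need three distinct weights.\<close>

lemma nilpotent_P3_5: "poisson_nilpotent (P3_5 :: 'f::field alg3)"
  unfolding P3_5_def
  by (rule nilpotent_table_algebra[where w = "\<lambda>i. if i = 3 then 2 else if i = 2 then 1 else 0"];
      auto simp: axis_def split: if_splits)

lemma not_nilpotent_dim2_idempotent:
  "\<not> poisson_nilpotent (P2_3 :: 'f::field alg2)"
  "\<not> poisson_nilpotent (P2_4 :: 'f::field alg2)"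
  "\<not> poisson_nilpotent (P2_5 :: 'f::field alg2)"
  by (rule poisson_algebra.not_nilpotent_if_reproduced[where x = "ee 1" and y = "ee 1"];
      (rule poisson_table2 | simp add: P2_3_def P2_4_def P2_5_def table_defs))+

lemma not_nilpotent_dim3_idempotent_1:
  "\<not> poisson_nilpotent (P3_2 :: 'f::field alg3)"
  "\<not> poisson_nilpotent (P3_6 :: 'f::field alg3)"
  "\<not> poisson_nilpotent (P3_7 :: 'f::field alg3)"
  "\<not> poisson_nilpotent (P3_8 :: 'f::field alg3)"
  "\<not> poisson_nilpotent (P3_14 :: 'f::field alg3)"
  "\<not> poisson_nilpotent (P3_15 :: 'f::field alg3)"
  by (rule poisson_algebra.not_nilpotent_if_reproduced[where x = "ee 1" and y = "ee 1"];
      (rule poisson_table3 | simp add: P3_2_def P3_6_def P3_7_def P3_8_def P3_14_def P3_15_def table_defs))+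

lemma not_nilpotent_dim3_idempotent_3:
  "\<not> poisson_nilpotent (P3_19 :: 'f::field alg3)"
  "\<not> poisson_nilpotent (P3_20 :: 'f::field alg3)"
  by (rule poisson_algebra.not_nilpotent_if_reproduced[where x = "ee 3" and y = "ee 3"];
      (rule poisson_table3 | simp add: P3_19_def P3_20_def table_defs))+

text \<open>
  In \<open>P\<^sub>2\<^sub>,\<^sub>7\<close>, \<open>P\<^sub>3\<^sub>,\<^sub>1\<^sub>7\<close> and \<open>P\<^sub>3\<^sub>,\<^sub>1\<^sub>8\<close> one has \<open>[e\<^sub>1, e\<^sub>2] = e\<^sub>2\<close>.
  The series brackets its terms with arbitrary elements on the right, so the relation is used as \<open>[e\<^sub>2, -e\<^sub>1] = e\<^sub>2\<close>.
\<close>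

lemma not_nilpotent_P2_7: "\<not> poisson_nilpotent (P2_7 :: 'f::field alg2)"
  by (rule poisson_algebra.not_nilpotent_if_reproduced[where x = "ee 2" and y = "- ee 1"];
      (rule poisson_table2 | simp add: P2_7_def table_defs))

lemma not_nilpotent_dim3_bracket:
  "\<not> poisson_nilpotent (P3_17 :: 'f::field alg3)"
  "\<not> poisson_nilpotent (P3_18 :: 'f::field alg3)"
  by (rule poisson_algebra.not_nilpotent_if_reproduced[where x = "ee 2" and y = "- ee 1"];
      (rule poisson_table3 | simp add: P3_17_def P3_18_def table_defs))+

lemma not_nilpotent_base_field_product:
  "poisson_algebra Q \<Longrightarrow> \<not> poisson_nilpotent (direct_product base_field Q)"
  by (rule not_nilpotent_direct_product[where e = 1])
    (simp_all add: poisson_base_field, simp add: base_field_def)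

lemma not_nilpotent_P3_9:
  "field_extension_of_degree 2 h \<Longrightarrow> \<not> poisson_nilpotent (P3_9 h)"
  unfolding P3_9_def
  by (rule not_nilpotent_direct_product[where e = 1])
    (simp_all add: poisson_extension_algebra poisson_zero_line, simp add: extension_algebra_def)

lemma not_nilpotent_P3_10_P3_11_P3_12:
  "\<not> poisson_nilpotent P3_10"
  "\<not> poisson_nilpotent P3_11"
  "field_extension_of_degree 2 h \<Longrightarrow> \<not> poisson_nilpotent (P3_12 h)"
  unfolding P3_10_def P3_11_def P3_12_def
  by (intro not_nilpotent_base_field_product poisson_direct_product poisson_base_field
      poisson_dual_numbers; erule poisson_extension_algebra)+

lemma not_nilpotent_P2_6_P3_13:
  "field_extension_of_degree 2 h \<Longrightarrow> \<not> poisson_nilpotent (P2_6 h)"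
  "field_extension_of_degree 3 k \<Longrightarrow> \<not> poisson_nilpotent (P3_13 k)"
  unfolding P2_6_def P3_13_def by (rule not_nilpotent_extension_algebra, assumption)+

theorem proposition5p8:
  assumes char_ne_2: "CHAR('f::field) \<noteq> 2"
  shows
    "(poisson_nilpotent (P2_1 :: 'f alg2) \<and>
      poisson_nilpotent (P2_2 :: 'f alg2) \<and>
      \<not> poisson_nilpotent (P2_3 :: 'f alg2) \<and>
      \<not> poisson_nilpotent (P2_4 :: 'f alg2) \<and>
      \<not> poisson_nilpotent (P2_5 :: 'f alg2) \<and>
      (\<forall>h :: 'f \<Rightarrow> 'e::field. field_extension_of_degree 2 h \<longrightarrow> \<not> poisson_nilpotent (P2_6 h)) \<and>
      \<not> poisson_nilpotent (P2_7 :: 'f alg2))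
     \<and>
     (poisson_nilpotent (P3_1 :: 'f alg3) \<and>
      \<not> poisson_nilpotent (P3_2 :: 'f alg3) \<and>
      poisson_nilpotent (P3_3 :: 'f alg3) \<and>
      (\<forall>M :: 'f ^ 2 ^ 2. transpose M = M \<and> det M \<noteq> 0 \<longrightarrow> poisson_nilpotent (P3_4 M)) \<and>
      poisson_nilpotent (P3_5 :: 'f alg3) \<and>
      \<not> poisson_nilpotent (P3_6 :: 'f alg3) \<and>
      \<not> poisson_nilpotent (P3_7 :: 'f alg3) \<and>
      \<not> poisson_nilpotent (P3_8 :: 'f alg3) \<and>
      (\<forall>h :: 'f \<Rightarrow> 'e. field_extension_of_degree 2 h \<longrightarrow> \<not> poisson_nilpotent (P3_9 h)) \<and>
      \<not> poisson_nilpotent (P3_10 :: ('f, 'f \<times> 'f \<times> 'f) poisson_data) \<and>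
      \<not> poisson_nilpotent (P3_11 :: ('f, 'f \<times> 'f \<times> 'f) poisson_data) \<and>
      (\<forall>h :: 'f \<Rightarrow> 'e. field_extension_of_degree 2 h \<longrightarrow> \<not> poisson_nilpotent (P3_12 h)) \<and>
      (\<forall>k :: 'f \<Rightarrow> 'k::field. field_extension_of_degree 3 k \<longrightarrow> \<not> poisson_nilpotent (P3_13 k)) \<and>
      \<not> poisson_nilpotent (P3_14 :: 'f alg3) \<and>
      \<not> poisson_nilpotent (P3_15 :: 'f alg3) \<and>
      (\<forall>M :: 'f ^ 2 ^ 2. transpose M = M \<longrightarrow> poisson_nilpotent (P3_16 M)) \<and>
      \<not> poisson_nilpotent (P3_17 :: 'f alg3) \<and>
      \<not> poisson_nilpotent (P3_18 :: 'f alg3) \<and>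
      \<not> poisson_nilpotent (P3_19 :: 'f alg3) \<and>
      \<not> poisson_nilpotent (P3_20 :: 'f alg3) \<and>
      (\<forall>A :: 'f ^ 2 ^ 2. invertible A \<longrightarrow> \<not> poisson_nilpotent (P3_21 A)) \<and>
      (\<forall>(s :: 'f \<Rightarrow> 'a::ab_group_add \<Rightarrow> 'a) b.
         simple_lie_algebra s b \<and> vector_space.dim s UNIV = 3 \<longrightarrow>
         \<not> poisson_nilpotent (P3_23 s b)))"
  by (intro conjI allI impI; (elim conjE)?;
      rule nilpotent_dim2 nilpotent_dim3 nilpotent_P3_5 not_nilpotent_dim2_idempotent
        not_nilpotent_P2_7 not_nilpotent_dim3_idempotent_1 not_nilpotent_dim3_idempotent_3
        not_nilpotent_dim3_bracket not_nilpotent_P3_9 not_nilpotent_P3_21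
        not_nilpotent_P3_10_P3_11_P3_12 not_nilpotent_P2_6_P3_13
        not_nilpotent_simple_lie_algebra; assumption?)

end
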